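(* Let $(b,c,d)$ be a non-associative triad in the Cayley-Dickson algebra $\mathbb A_n$, $n\ge3$. Then: 1. The first Moufang identity $d(b(dc))-((db)d)c=0$ holds if and only if $(b,c,d)$ has non-associativity type B or X. 2. The second Moufang identity $b(d(cd))-((bd)c)d=0$ holds if and only if $(b,c,d)$ has non-associativity type C or X. 3. The third Moufang identity $(db)(cd)-(d(bc))d=0$ holds if and only if: $(b,c,d)$ has non-associativity type B or X in the case that $(b,c,d)$ satisfies Mal'cev's identity, and $(b,c,d)$ has non-associativity type A or C in the case that it does not.
   Context: The real algebras $\mathbb A_n$ are defined recursively: $\mathbb A_0=\mathbb R$ with trivial conjugation, and $\mathbb A_n=\mathbb A_{n-1}\oplus\mathbb A_{n-1}$ with $(x,y)(z,w)=(xz-w^*y,\; wx+yz^* )$ and $(x,y)^*=(x^*,-y)$. The graded basis of $\mathbb A_n$ is $\{\mathrm o_\alpha:\alpha\subseteq\{1,\dots,n\}\}$, with $\mathrm o_\emptyset=1$ and, for $\alpha\subseteq\{1,\dots,n-1\}$, $\mathrm o_\alpha=(\mathrm o_\alpha,0)$ and $\mathrm o_{\alpha\cup\{n\}}=(0,\mathrm o_\alpha)$. Pure basis elements are those with $\alpha\neq\emptyset$. The natural order on basis elements is: $\mathrm o_\alpha<\mathrm o_\beta$ iff $\alpha\ne\beta$ and the largest element of the symmetric difference of $\alpha$ and $\beta$ lies in $\beta$. A triad is a triple $(b,c,d)$ of pure basis elements with $b<c<d$. The associator is $[x,y,z]=(xy)z-x(yz)$. For a triad $(b,c,d)$, the Type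 1, Type 2 and Type 3 associators are respectively $[b,d,c]$, $[b,c,d]$ and $[c,b,d]$. The triad is non-associative if $[b,d,c]-[d,c,b]+[c,b,d]\neq0$. A non-associative triad has non-associativity type: A if only the Type 1 associator is non-zero; B if only the Type 2 associator is non-zero; C if only the Type 3 associator is non-zero; X if all three are non-zero. For a triad, Mal'cev's identity (for the product $x\ast y=\frac12(xy-yx)$) takes the form $((bc)d)b+(bc)(db)=0$; the triad satisfies Mal'cev's identity if this equation holds. *)

theory Defs
  imports Complex_Main
begin

text \<open>
  The algebras \<open>A\<^sub>n\<close> live in one type: an element of \<open>A\<^sub>n\<close> is a full binary tree of depth \<open>n\<close>
  with real leaves, \<open>CDpair x y\<close> being the pair \<open>(x, y)\<close>.  The carrier of \<open>A\<^sub>n\<close> is \<open>cd_algebra n\<close>.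
  The operations below do not mention \<open>n\<close>; on trees of different shapes they are unspecified.
  For the same reason the zero element has to be indexed by \<open>n\<close>.
\<close>

datatype cd = CDreal real | CDpair cd cd

primrec cd_algebra :: "nat \<Rightarrow> cd set" where
  "cd_algebra 0 = range CDreal"
| "cd_algebra (Suc n) = {CDpair x y | x y. x \<in> cd_algebra n \<and> y \<in> cd_algebra n}"

primrec cd_zero :: "nat \<Rightarrow> cd" where
  "cd_zero 0 = CDreal 0"
| "cd_zero (Suc n) = CDpair (cd_zero n) (cd_zero n)"

instantiation cd :: "{plus, minus, uminus}"
begin

fun plus_cd :: "cd \<Rightarrow> cd \<Rightarrow> cd" where
  "CDreal x + CDreal y = CDreal (x + y)"
| "CDpair x y + CDpair z w = CDpair (x + z) (y + w)"

fun minus_cd :: "cd \<Rightarrow> cd \<Rightarrow> cd" where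
  "CDreal x - CDreal y = CDreal (x - y)"
| "CDpair x y - CDpair z w = CDpair (x - z) (y - w)"

primrec uminus_cd :: "cd \<Rightarrow> cd" where
  "- CDreal x = CDreal (- x)"
| "- CDpair x y = CDpair (- x) (- y)"

instance ..

end

primrec cd_conj :: "cd \<Rightarrow> cd" where
  "cd_conj (CDreal x) = CDreal x"
| "cd_conj (CDpair x y) = CDpair (cd_conj x) (- y)"

lemma size_uminus_cd [simp]: "size (- x :: cd) = size x"
  by (induction x) auto

lemma size_cd_conj [simp]: "size (cd_conj x) = size x"
  by (induction x) auto

instantiation cd :: times
begin

function (sequential) times_cd :: "cd \<Rightarrow> cd \<Rightarrow> cd" where
  "CDreal x * CDreal y = CDreal (x * y)"
| "CDpair x y * CDpair z w = CDpair (x * z - cd_conj w * y) (w * x + y * cd_conj z)"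
  by pat_completeness auto
termination
  by (relation "measure (\<lambda>(x, y). size x + size y)") auto

instance ..

end

text \<open>\<open>cd_basis n \<alpha>\<close> is \<open>o\<^sub>\<alpha>\<close> in \<open>A\<^sub>n\<close>, intended for \<open>\<alpha> \<subseteq> {1..n}\<close>.\<close>

primrec cd_basis :: "nat \<Rightarrow> nat set \<Rightarrow> cd" where
  "cd_basis 0 \<alpha> = CDreal 1"
| "cd_basis (Suc n) \<alpha> =
     (if Suc n \<in> \<alpha> then CDpair (cd_zero n) (cd_basis n (\<alpha> - {Suc n}))
      else CDpair (cd_basis n \<alpha>) (cd_zero n))"

lemma cd_zero_in_cd_algebra: "cd_zero n \<in> cd_algebra n"
  by (induction n) auto

lemma cd_basis_in_cd_algebra: "cd_basis n \<alpha> \<in> cd_algebra n"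
  by (induction n arbitrary: \<alpha>) (auto simp: cd_zero_in_cd_algebra)

lemma cd_add_in_cd_algebra:
  "x \<in> cd_algebra n \<Longrightarrow> y \<in> cd_algebra n \<Longrightarrow> x + y \<in> cd_algebra n"
  by (induction n arbitrary: x y) auto

lemma cd_diff_in_cd_algebra:
  "x \<in> cd_algebra n \<Longrightarrow> y \<in> cd_algebra n \<Longrightarrow> x - y \<in> cd_algebra n"
  by (induction n arbitrary: x y) auto

lemma cd_uminus_in_cd_algebra: "x \<in> cd_algebra n \<Longrightarrow> - x \<in> cd_algebra n"
  by (induction n arbitrary: x) auto

lemma cd_conj_in_cd_algebra: "x \<in> cd_algebra n \<Longrightarrow> cd_conj x \<in> cd_algebra n"
  by (induction n arbitrary: x) (auto simp: cd_uminus_in_cd_algebra)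

lemma cd_mult_in_cd_algebra:
  "x \<in> cd_algebra n \<Longrightarrow> y \<in> cd_algebra n \<Longrightarrow> x * y \<in> cd_algebra n"
  by (induction n arbitrary: x y)
    (auto simp: cd_add_in_cd_algebra cd_diff_in_cd_algebra cd_conj_in_cd_algebra)

definition cd_pure_basis :: "nat \<Rightarrow> cd set" where
  "cd_pure_basis n = {cd_basis n \<alpha> | \<alpha>. \<alpha> \<subseteq> {1..n} \<and> \<alpha> \<noteq> {}}"

definition cd_basis_less :: "nat \<Rightarrow> cd \<Rightarrow> cd \<Rightarrow> bool" where
  "cd_basis_less n x y \<longleftrightarrow>
     (\<exists>\<alpha> \<beta>. \<alpha> \<subseteq> {1..n} \<and> \<beta> \<subseteq> {1..n} \<and> x = cd_basis n \<alpha> \<and> y = cd_basis n \<beta> \<and>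
            \<alpha> \<noteq> \<beta> \<and> Max ((\<alpha> - \<beta>) \<union> (\<beta> - \<alpha>)) \<in> \<beta>)"

definition triad :: "nat \<Rightarrow> cd \<Rightarrow> cd \<Rightarrow> cd \<Rightarrow> bool" where
  "triad n b c d \<longleftrightarrow>
     b \<in> cd_pure_basis n \<and> c \<in> cd_pure_basis n \<and> d \<in> cd_pure_basis n \<and>
     cd_basis_less n b c \<and> cd_basis_less n c d"

definition associator :: "cd \<Rightarrow> cd \<Rightarrow> cd \<Rightarrow> cd" where
  "associator x y z = (x * y) * z - x * (y * z)"

definition nonassoc_triad :: "nat \<Rightarrow> cd \<Rightarrow> cd \<Rightarrow> cd \<Rightarrow> bool" where
  "nonassoc_triad n b c d \<longleftrightarrow>
     triad n b c d \<and> associator b d c - associator d c b + associator c b d \<noteq> cd_zero n"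

definition type_A :: "nat \<Rightarrow> cd \<Rightarrow> cd \<Rightarrow> cd \<Rightarrow> bool" where
  "type_A n b c d \<longleftrightarrow> nonassoc_triad n b c d \<and>
     associator b d c \<noteq> cd_zero n \<and> associator b c d = cd_zero n \<and> associator c b d = cd_zero n"

definition type_B :: "nat \<Rightarrow> cd \<Rightarrow> cd \<Rightarrow> cd \<Rightarrow> bool" where
  "type_B n b c d \<longleftrightarrow> nonassoc_triad n b c d \<and>
     associator b d c = cd_zero n \<and> associator b c d \<noteq> cd_zero n \<and> associator c b d = cd_zero n"

definition type_C :: "nat \<Rightarrow> cd \<Rightarrow> cd \<Rightarrow> cd \<Rightarrow> bool" where
  "type_C n b c d \<longleftrightarrow> nonassoc_triad n b c d \<and>
     associator b d c = cd_zero n \<and> associator b c d = cd_zero n \<and> associator c b d \<noteq> cd_zero n"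

definition type_X :: "nat \<Rightarrow> cd \<Rightarrow> cd \<Rightarrow> cd \<Rightarrow> bool" where
  "type_X n b c d \<longleftrightarrow> nonassoc_triad n b c d \<and>
     associator b d c \<noteq> cd_zero n \<and> associator b c d \<noteq> cd_zero n \<and> associator c b d \<noteq> cd_zero n"

text \<open>The form that Mal'cev's identity for the product \<open>(xy - yx)/2\<close> takes on a triad.\<close>

definition malcev_identity :: "nat \<Rightarrow> cd \<Rightarrow> cd \<Rightarrow> cd \<Rightarrow> bool" where
  "malcev_identity n b c d \<longleftrightarrow> ((b * c) * d) * b + (b * c) * (d * b) = cd_zero n"

end

theory Submission
  imports Defs
begin

text \<open>
  Products of basis elements are basis elements up to sign, and distinct pure basis elements
  anticommute. If \<open>b\<close>, \<open>c\<close>, \<open>d\<close> form a non-associative triad, then they are independent, so every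
  word in them is determined by the three signs in \<open>b(cd) = \<plusminus>(bc)d\<close>, \<open>(bd)c = \<plusminus>(bc)d\<close> and
  \<open>(bd)(cd) = \<plusminus>bc\<close>. The first two signs determine the non-associativity type; the first Moufang
  identity fixes the first sign, the second Moufang identity the second sign, the third Moufang
  identity the third sign, and Mal'cev's identity says that the first and third signs agree.
\<close>

section \<open>Zero, signs and conjugation in \<open>cd_algebra n\<close>\<close>

lemma cd_minus_minus [simp]: "- (- x) = (x :: cd)"
  by (induction x) auto

lemma cd_conj_minus: "cd_conj (- x) = - cd_conj x"
  by (induction x) auto

lemma cd_conj_conj [simp]: "cd_conj (cd_conj x) = x"
  by (induction x) auto

lemma cd_minus_zero [simp]: "- cd_zero n = cd_zero n"
  by (induction n) auto

lemma cd_conj_zero [simp]: "cd_conj (cd_zero n) = cd_zero n"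
  by (induction n) auto

lemma cd_zero_add: "x \<in> cd_algebra n \<Longrightarrow> cd_zero n + x = x"
  by (induction n arbitrary: x) auto

lemma cd_add_zero: "x \<in> cd_algebra n \<Longrightarrow> x + cd_zero n = x"
  by (induction n arbitrary: x) auto

lemma cd_diff_zero: "x \<in> cd_algebra n \<Longrightarrow> x - cd_zero n = x"
  by (induction n arbitrary: x) auto

lemma cd_zero_diff: "x \<in> cd_algebra n \<Longrightarrow> cd_zero n - x = - x"
  by (induction n arbitrary: x) auto

text \<open>Both laws go through one induction: the doubling formula puts the zero on the left in
  some terms and on the right in others.\<close>

lemma cd_zero_mult: "x \<in> cd_algebra n \<Longrightarrow> cd_zero n * x = cd_zero n"
  and cd_mult_zero: "x \<in> cd_algebra n \<Longrightarrow> x * cd_zero n = cd_zero n"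
  by (induction n arbitrary: x)
    (auto simp: cd_zero_add cd_diff_zero cd_conj_in_cd_algebra cd_zero_in_cd_algebra)

lemma cd_add_commute:
  "x \<in> cd_algebra n \<Longrightarrow> y \<in> cd_algebra n \<Longrightarrow> x + y = (y :: cd) + x"
  by (induction n arbitrary: x y) auto

lemma cd_minus_add:
  "x \<in> cd_algebra n \<Longrightarrow> y \<in> cd_algebra n \<Longrightarrow> - (x + y) = - x + - (y :: cd)"
  by (induction n arbitrary: x y) auto

lemma cd_minus_diff:
  "x \<in> cd_algebra n \<Longrightarrow> y \<in> cd_algebra n \<Longrightarrow> - (x - y) = - x - - (y :: cd)"
  by (induction n arbitrary: x y) auto

lemma cd_conj_diff:
  "x \<in> cd_algebra n \<Longrightarrow> y \<in> cd_algebra n \<Longrightarrow> cd_conj (x - y) = cd_conj x - cd_conj y"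
  by (induction n arbitrary: x y) (auto simp: cd_minus_diff)

lemma cd_diff_eq_zero_iff:
  "x \<in> cd_algebra n \<Longrightarrow> y \<in> cd_algebra n \<Longrightarrow> x - y = cd_zero n \<longleftrightarrow> x = y"
  by (induction n arbitrary: x y) auto

lemma cd_add_eq_zero_iff:
  "x \<in> cd_algebra n \<Longrightarrow> y \<in> cd_algebra n \<Longrightarrow> x + y = cd_zero n \<longleftrightarrow> x = - y"
  by (induction n arbitrary: x y) auto

lemma cd_minus_mult_left:
    "x \<in> cd_algebra n \<Longrightarrow> y \<in> cd_algebra n \<Longrightarrow> - x * y = - (x * (y :: cd))"
  and cd_minus_mult_right:
    "x \<in> cd_algebra n \<Longrightarrow> y \<in> cd_algebra n \<Longrightarrow> x * - y = - (x * (y :: cd))"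
proof (induction n arbitrary: x y)
  case (Suc n)
  note closed = cd_uminus_in_cd_algebra cd_conj_in_cd_algebra cd_mult_in_cd_algebra
  {
    case 1
    then obtain p q r s where "x = CDpair p q" "y = CDpair r s"
      "p \<in> cd_algebra n" "q \<in> cd_algebra n" "r \<in> cd_algebra n" "s \<in> cd_algebra n"
      by auto
    then show ?case
      by (simp add: Suc.IH closed cd_minus_add[where n = n] cd_minus_diff[where n = n])
  next
    case 2
    then obtain p q r s where "x = CDpair p q" "y = CDpair r s"
      "p \<in> cd_algebra n" "q \<in> cd_algebra n" "r \<in> cd_algebra n" "s \<in> cd_algebra n"
      by auto
    then show ?case
      by (simp add: Suc.IH closed cd_conj_minus cd_minus_add[where n = n]
          cd_minus_diff[where n = n])
  }
qed auto

text \<open>Expand both sides by the doubling formula. The first components agree by induction, the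
  second ones up to the order of their two summands.\<close>

lemma cd_conj_mult:
  "x \<in> cd_algebra n \<Longrightarrow> y \<in> cd_algebra n \<Longrightarrow> cd_conj (x * y) = cd_conj y * cd_conj x"
proof (induction n arbitrary: x y)
  case (Suc n)
  note closed = cd_uminus_in_cd_algebra cd_conj_in_cd_algebra cd_mult_in_cd_algebra
  from Suc.prems obtain p q r s where "x = CDpair p q" "y = CDpair r s"
    "p \<in> cd_algebra n" "q \<in> cd_algebra n" "r \<in> cd_algebra n" "s \<in> cd_algebra n"
    by auto
  then show ?case
    by (simp add: Suc.IH closed cd_conj_minus cd_conj_diff[where n = n]
        cd_minus_mult_left[where n = n] cd_minus_mult_right[where n = n]
        cd_minus_add[where n = n] cd_add_commute[where n = n])
qed auto

section \<open>Basis elements up to sign and their products\<close>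

lemma cd_basis_ne_minus: "cd_basis n \<alpha> \<noteq> - cd_basis n \<alpha>"
  by (induction n arbitrary: \<alpha>) auto

text \<open>This allows the recursion for \<open>cd_basis\<close> to keep \<open>Suc n\<close> in
  the index set, so that one set serves at every level.\<close>

lemma cd_basis_cong:
  "\<alpha> \<inter> {1..n} = \<beta> \<inter> {1..n} \<Longrightarrow> cd_basis n \<alpha> = cd_basis n \<beta>"
proof (induction n arbitrary: \<alpha> \<beta>)
  case (Suc n)
  have "Suc n \<in> \<alpha> \<longleftrightarrow> Suc n \<in> \<beta>"
    using Suc.prems by fastforce
  moreover have eq: "x \<in> \<alpha> \<longleftrightarrow> x \<in> \<beta>" if "x \<in> {1..n}" for x
    using that Suc.prems by fastforce
  have "cd_basis n \<alpha> = cd_basis n \<beta>"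
    using eq by (intro Suc.IH) blast
  moreover have "cd_basis n (\<alpha> - {Suc n}) = cd_basis n (\<beta> - {Suc n})"
    using eq by (intro Suc.IH) blast
  ultimately show ?case by simp
qed simp

lemma cd_basis_Suc:
  "cd_basis (Suc n) \<alpha> =
     (if Suc n \<in> \<alpha> then CDpair (cd_zero n) (cd_basis n \<alpha>)
      else CDpair (cd_basis n \<alpha>) (cd_zero n))"
  by (auto intro: cd_basis_cong)

lemma cd_conj_basis:
  "cd_conj (cd_basis n \<alpha>) =
     (if \<alpha> \<inter> {1..n} = {} then cd_basis n \<alpha> else - cd_basis n \<alpha>)"
proof (induction n arbitrary: \<alpha>)
  case (Suc n)
  then show ?case
    by (simp add: cd_basis_Suc atLeastAtMostSuc_conv del: cd_basis.simps(2))
qed simp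

text \<open>The sign is left open: products then only require their index to be computed, never the
  structure constants.\<close>

definition signed_basis :: "nat \<Rightarrow> nat set \<Rightarrow> cd set" where
  "signed_basis n \<alpha> = {cd_basis n \<alpha>, - cd_basis n \<alpha>}"

lemma signed_basis_in_cd_algebra: "x \<in> signed_basis n \<alpha> \<Longrightarrow> x \<in> cd_algebra n"
  by (auto simp: signed_basis_def cd_basis_in_cd_algebra cd_uminus_in_cd_algebra)

lemma minus_signed_basis: "x \<in> signed_basis n \<alpha> \<Longrightarrow> - x \<in> signed_basis n \<alpha>"
  by (auto simp: signed_basis_def)

lemma signed_basis_ne_minus: "x \<in> signed_basis n \<alpha> \<Longrightarrow> x \<noteq> - x"
  using cd_basis_ne_minus[of n \<alpha>] by (auto simp: signed_basis_def)

lemma signed_basis_cases: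
  "x \<in> signed_basis n \<alpha> \<Longrightarrow> y \<in> signed_basis n \<alpha> \<Longrightarrow> x = y \<or> x = - y"
  by (auto simp: signed_basis_def)

lemma conj_signed_basis: "x \<in> signed_basis n \<alpha> \<Longrightarrow> cd_conj x \<in> signed_basis n \<alpha>"
  by (auto simp: signed_basis_def cd_conj_basis cd_conj_minus split: if_splits)

lemma conj_signed_basis_pure:
  "x \<in> signed_basis n \<alpha> \<Longrightarrow> \<alpha> \<inter> {1..n} \<noteq> {} \<Longrightarrow> cd_conj x = - x"
  unfolding signed_basis_def by (elim insertE emptyE) (simp_all add: cd_conj_basis cd_conj_minus)

lemma signed_basis_SucE:
  assumes "x \<in> signed_basis (Suc n) \<alpha>"
  obtains (left) p where "x = CDpair p (cd_zero n)" "p \<in> signed_basis n \<alpha>" "Suc n \<notin> \<alpha>"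
    | (right) q where "x = CDpair (cd_zero n) q" "q \<in> signed_basis n \<alpha>" "Suc n \<in> \<alpha>"
  using assms
  by (auto simp: signed_basis_def cd_basis_Suc simp del: cd_basis.simps(2) split: if_splits)

lemma signed_basis_SucI:
  "p \<in> signed_basis n \<alpha> \<Longrightarrow> Suc n \<notin> \<alpha> \<Longrightarrow> CDpair p (cd_zero n) \<in> signed_basis (Suc n) \<alpha>"
  "q \<in> signed_basis n \<alpha> \<Longrightarrow> Suc n \<in> \<alpha> \<Longrightarrow> CDpair (cd_zero n) q \<in> signed_basis (Suc n) \<alpha>"
  by (auto simp: signed_basis_def cd_basis_Suc simp del: cd_basis.simps(2))

lemmas cd_zero_simps =
  cd_zero_add cd_add_zero cd_diff_zero cd_zero_diff cd_zero_mult cd_mult_zero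
  cd_zero_in_cd_algebra cd_mult_in_cd_algebra cd_conj_in_cd_algebra cd_uminus_in_cd_algebra
  signed_basis_in_cd_algebra

text \<open>One component of each factor is zero, so only one of the four products in the doubling
  formula survives. The index \<open>Suc n\<close> cancels when both factors carry it.\<close>

lemma mult_signed_basis:
  "x \<in> signed_basis n \<alpha> \<Longrightarrow> y \<in> signed_basis n \<beta> \<Longrightarrow>
     x * y \<in> signed_basis n (sym_diff \<alpha> \<beta>)"
proof (induction n arbitrary: x y \<alpha> \<beta>)
  case 0
  then show ?case by (auto simp: signed_basis_def)
next
  case (Suc n)
  \<comment> \<open>A second factor of the form \<open>(0, s)\<close> ends up on the left in the
    doubling formula, so the induction hypothesis is also needed with the indices exchanged.\<close>
  have IH': "u * v \<in> signed_basis n (sym_diff \<alpha> \<beta>)"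
    if "u \<in> signed_basis n \<beta>" "v \<in> signed_basis n \<alpha>" for u v
    using Suc.IH[OF that] by (simp add: Un_commute)
  show ?case
    using Suc.prems(1)
  proof (cases rule: signed_basis_SucE)
    case x: (left p)
    note p = signed_basis_in_cd_algebra[OF x(2)]
    show ?thesis using Suc.prems(2)
    proof (cases rule: signed_basis_SucE)
      case y: (left r)
      note r = signed_basis_in_cd_algebra[OF y(2)]
      show ?thesis using x y p r Suc.IH
        by (simp add: cd_zero_simps[where n = n] signed_basis_SucI)
    next
      case y: (right s)
      note s = signed_basis_in_cd_algebra[OF y(2)]
      show ?thesis using x y p s IH'
        by (simp add: cd_zero_simps[where n = n] signed_basis_SucI)
    qed
  next
    case x: (right q)
    note q = signed_basis_in_cd_algebra[OF x(2)]
    show ?thesis using Suc.prems(2)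
    proof (cases rule: signed_basis_SucE)
      case y: (left r)
      note r = signed_basis_in_cd_algebra[OF y(2)]
      show ?thesis using x y q r Suc.IH
        by (simp add: cd_zero_simps[where n = n] signed_basis_SucI conj_signed_basis)
    next
      case y: (right s)
      note s = signed_basis_in_cd_algebra[OF y(2)]
      show ?thesis using x y q s IH'
        by (simp add: cd_zero_simps[where n = n] signed_basis_SucI conj_signed_basis
            minus_signed_basis)
    qed
  qed
qed

text \<open>A substitute for alternativity, which fails for general elements once
  \<open>n \<ge> 4\<close>. For basis elements the doubling formula reduces it to cancellation laws
  one level down.\<close>

lemma conj_mult_cancel_left:
  "x \<in> signed_basis n \<alpha> \<Longrightarrow> y \<in> signed_basis n \<beta> \<Longrightarrow> cd_conj x * (x * y) = y"
proof (induction n arbitrary: x y \<alpha> \<beta>)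
  case 0
  then show ?case by (auto simp: signed_basis_def)
next
  case (Suc n)
  have IH': "u * (cd_conj u * v) = v" if "u \<in> signed_basis n \<alpha>'" "v \<in> signed_basis n \<beta>'"
    for u v \<alpha>' \<beta>'
    using Suc.IH[OF conj_signed_basis[OF that(1)] that(2)] by simp
  \<comment> \<open>Doubling reverses some products, so right cancellation is needed too; it is the
    conjugate of left cancellation.\<close>
  have right: "(v * cd_conj u) * u = v" "(v * u) * cd_conj u = v"
    if "u \<in> signed_basis n \<alpha>'" "v \<in> signed_basis n \<beta>'" for u v \<alpha>' \<beta>'
  proof -
    note uv = that[THEN signed_basis_in_cd_algebra]
    have "cd_conj ((v * cd_conj u) * u) = cd_conj v" "cd_conj ((v * u) * cd_conj u) = cd_conj v"
      using uv Suc.IH[OF that(1) conj_signed_basis[OF that(2)]]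
        IH'[OF that(1) conj_signed_basis[OF that(2)]]
      by (simp_all add: cd_conj_mult[where n = n] cd_mult_in_cd_algebra cd_conj_in_cd_algebra)
    then show "(v * cd_conj u) * u = v" "(v * u) * cd_conj u = v"
      by (metis cd_conj_conj)+
  qed
  note simps = cd_zero_simps[where n = n] cd_conj_mult[where n = n]
    cd_minus_mult_left[where n = n] cd_minus_mult_right[where n = n] cd_conj_minus
  show ?case
    using Suc.prems(1)
  proof (cases rule: signed_basis_SucE)
    case x: (left p)
    note p = signed_basis_in_cd_algebra[OF x(2)]
    show ?thesis using Suc.prems(2)
    proof (cases rule: signed_basis_SucE)
      case y: (left r)
      note r = signed_basis_in_cd_algebra[OF y(2)]
      show ?thesis using x p r Suc.IH[OF x(2) y(2)] by (simp add: y simps)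
    next
      case y: (right s)
      note s = signed_basis_in_cd_algebra[OF y(2)]
      show ?thesis using x p s right[OF x(2) y(2)] by (simp add: y simps)
    qed
  next
    case x: (right q)
    note q = signed_basis_in_cd_algebra[OF x(2)]
    show ?thesis using Suc.prems(2)
    proof (cases rule: signed_basis_SucE)
      case y: (left r)
      note r = signed_basis_in_cd_algebra[OF y(2)]
      show ?thesis using x q r right[OF x(2) y(2)] by (simp add: y simps)
    next
      case y: (right s)
      note s = signed_basis_in_cd_algebra[OF y(2)]
      show ?thesis using x q s IH'[OF x(2) y(2)] by (simp add: y simps)
    qed
  qed
qed

section \<open>Calculation with pure basis elements\<close>

text \<open>Signs are allowed so that the product of two such elements with different indices is
  again of this kind. Restricting \<alpha> to \<open>{1..n}\<close> makes a nonempty index really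
  imaginary.\<close>

definition pure_basis_at :: "nat \<Rightarrow> nat set \<Rightarrow> cd \<Rightarrow> bool" where
  "pure_basis_at n \<alpha> x \<longleftrightarrow> \<alpha> \<subseteq> {1..n} \<and> \<alpha> \<noteq> {} \<and> x \<in> signed_basis n \<alpha>"

lemma pure_basis_at_in_cd_algebra: "pure_basis_at n \<alpha> x \<Longrightarrow> x \<in> cd_algebra n"
  by (auto simp: pure_basis_at_def intro: signed_basis_in_cd_algebra)

lemma pure_basis_at_mult:
  "pure_basis_at n \<alpha> x \<Longrightarrow> pure_basis_at n \<beta> y \<Longrightarrow> \<alpha> \<noteq> \<beta> \<Longrightarrow>
     pure_basis_at n (sym_diff \<alpha> \<beta>) (x * y)"
  using mult_signed_basis unfolding pure_basis_at_def by blast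

lemma pure_basis_at_conj: "pure_basis_at n \<alpha> x \<Longrightarrow> cd_conj x = - x"
  unfolding pure_basis_at_def by (intro conj_signed_basis_pure) auto

lemma pure_basis_at_cases:
  "pure_basis_at n \<alpha> x \<Longrightarrow> pure_basis_at n \<alpha> y \<Longrightarrow> x = y \<or> x = - y"
  unfolding pure_basis_at_def using signed_basis_cases by blast

lemma pure_basis_at_ne_minus: "pure_basis_at n \<alpha> x \<Longrightarrow> x \<noteq> - x"
  unfolding pure_basis_at_def using signed_basis_ne_minus by blast

text \<open>As the indices differ, \<open>x * y\<close> is pure, so conjugation negates it;
  conjugation also turns it into \<open>(- y) * (- x)\<close>.\<close>

lemma pure_basis_at_anticommute:
  assumes "pure_basis_at n \<alpha> x" "pure_basis_at n \<beta> y" "\<alpha> \<noteq> \<beta>"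
  shows "y * x = - (x * y)"
proof -
  note xy = assms(1,2)[THEN pure_basis_at_in_cd_algebra]
  have "- (x * y) = cd_conj (x * y)"
    using pure_basis_at_conj[OF pure_basis_at_mult[OF assms]] by simp
  also have "\<dots> = - y * - x"
    using xy assms by (simp add: cd_conj_mult[where n = n] pure_basis_at_conj)
  also have "\<dots> = y * x"
    using xy by (simp add: cd_minus_mult_left[where n = n] cd_minus_mult_right[where n = n]
        cd_uminus_in_cd_algebra)
  finally show ?thesis by simp
qed

lemma pure_basis_at_mult_left:
  assumes "pure_basis_at n \<alpha> x" "pure_basis_at n \<beta> y"
  shows "x * (x * y) = - y"
proof -
  note xy = assms[THEN pure_basis_at_in_cd_algebra]
  have "cd_conj x * (x * y) = y"
    using assms conj_mult_cancel_left unfolding pure_basis_at_def by blast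
  then have "- (x * (x * y)) = y"
    using xy by (simp add: pure_basis_at_conj[OF assms(1)] cd_minus_mult_left[where n = n]
        cd_mult_in_cd_algebra)
  then show ?thesis by (metis cd_minus_minus)
qed

lemma pure_basis_at_mult_right:
  assumes "pure_basis_at n \<alpha> x" "pure_basis_at n \<beta> y"
  shows "(y * x) * x = - y"
proof -
  note xy = assms[THEN pure_basis_at_in_cd_algebra]
  \<comment> \<open>Conjugation reverses the products and so reduces the claim to the left-hand
    law.\<close>
  have "cd_conj ((y * x) * x) = - x * (- x * - y)"
    using xy assms by (simp add: cd_conj_mult[where n = n] cd_mult_in_cd_algebra
        pure_basis_at_conj)
  also have "\<dots> = - (x * (x * y))"
    using xy by (simp add: cd_minus_mult_left[where n = n] cd_minus_mult_right[where n = n]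
        cd_uminus_in_cd_algebra cd_mult_in_cd_algebra)
  also have "\<dots> = cd_conj (- y)"
    by (simp add: pure_basis_at_mult_left[OF assms] pure_basis_at_conj[OF assms(2)] cd_conj_minus)
  finally show ?thesis by (metis cd_conj_conj)
qed

lemma pure_basis_at_flexible:
  assumes "pure_basis_at n \<alpha> x" "pure_basis_at n \<beta> y" "\<alpha> \<noteq> \<beta>"
  shows "(x * y) * x = y" "x * (y * x) = y"
proof -
  note xy = assms(1,2)[THEN pure_basis_at_in_cd_algebra]
  have anti: "x * y = - (y * x)"
    using pure_basis_at_anticommute[OF assms(2,1)] assms(3) by auto
  show "(x * y) * x = y"
    using xy by (simp add: anti cd_minus_mult_left[where n = n] cd_mult_in_cd_algebra
        pure_basis_at_mult_right[OF assms(1,2)])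
  show "x * (y * x) = y"
    using xy by (simp add: pure_basis_at_anticommute[OF assms] cd_minus_mult_right[where n = n]
        cd_mult_in_cd_algebra pure_basis_at_mult_left[OF assms(1,2)])
qed

lemma cd_mult_one: "x \<in> cd_algebra n \<Longrightarrow> x * cd_basis n {} = x"
  by (induction n arbitrary: x)
    (auto simp: cd_conj_basis cd_zero_mult cd_mult_zero cd_zero_add cd_diff_zero)

text \<open>The right unit law for \<open>cd_conj x\<close>, conjugated.\<close>

lemma cd_one_mult: "x \<in> cd_algebra n \<Longrightarrow> cd_basis n {} * x = x"
  using arg_cong[OF cd_mult_one[of "cd_conj x" n], of cd_conj]
  by (simp add: cd_conj_mult[where n = n] cd_conj_in_cd_algebra cd_basis_in_cd_algebra
      cd_conj_basis)

text \<open>Cancellation with the unit as second factor. The unit is not pure, so the law for signed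
  basis elements is used directly.\<close>

lemma pure_basis_at_square:
  assumes "pure_basis_at n \<alpha> x"
  shows "x * x = - cd_basis n {}"
proof -
  note x = pure_basis_at_in_cd_algebra[OF assms]
  have "cd_conj x * (x * cd_basis n {}) = cd_basis n {}"
    using assms by (intro conj_mult_cancel_left) (auto simp: pure_basis_at_def signed_basis_def)
  then have "- (x * x) = cd_basis n {}"
    using x by (simp add: cd_mult_one pure_basis_at_conj[OF assms] cd_minus_mult_left[where n = n])
  then show ?thesis by (metis cd_minus_minus)
qed

lemmas cd_closed =
  cd_uminus_in_cd_algebra cd_mult_in_cd_algebra cd_basis_in_cd_algebra

section \<open>Vanishing associators of dependent triples\<close>

text \<open>Elements with the same index agree up to sign, so the three claims are the left
  alternative, flexible and right alternative laws.\<close>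

lemma associator_repeated:
  assumes x: "pure_basis_at n \<alpha> x" and y: "pure_basis_at n \<alpha> y" and z: "pure_basis_at n \<beta> z"
  shows "associator x y z = cd_zero n" "associator x z y = cd_zero n"
    "associator z x y = cd_zero n"
proof -
  note in_alg = x[THEN pure_basis_at_in_cd_algebra] z[THEN pure_basis_at_in_cd_algebra]
  note rules = in_alg cd_closed[where n = n] cd_minus_mult_left[where n = n]
    cd_minus_mult_right[where n = n] cd_diff_eq_zero_iff[where n = n] pure_basis_at_square[OF x]
    cd_one_mult[where n = n] cd_mult_one[where n = n]
    pure_basis_at_mult_left[OF x z] pure_basis_at_mult_right[OF x z]
  \<comment> \<open>Anticommutation is only available for different indices. If the indices agree,
    \<open>z\<close> is \<open>x\<close> up to sign and squares suffice.\<close>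
  have flexible: "(x * z) * x = x * (z * x)"
  proof (cases "\<alpha> = \<beta>")
    case True
    then have "z = x \<or> z = - x"
      using pure_basis_at_cases x z by blast
    then show ?thesis by (auto simp: rules)
  next
    case False
    then show ?thesis using pure_basis_at_flexible[OF x z] by simp
  qed
  have "y = x \<or> y = - x"
    using pure_basis_at_cases x y by blast
  then show "associator x y z = cd_zero n" "associator x z y = cd_zero n"
    "associator z x y = cd_zero n"
    unfolding associator_def by (auto simp: rules flexible)
qed

text \<open>Here \<open>d\<close> is \<open>b * c\<close> up to sign, and \<open>b\<close>,
  \<open>c\<close>, \<open>b * c\<close> multiply like the quaternion units i, j, k.\<close>

lemma associator_quaternion:
  assumes b: "pure_basis_at n \<alpha> b" and c: "pure_basis_at n \<beta> c"
    and d: "pure_basis_at n (sym_diff \<alpha> \<beta>) d" and ne: "\<alpha> \<noteq> \<beta>"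
  shows "associator b d c = cd_zero n" "associator d c b = cd_zero n"
    "associator c b d = cd_zero n"
proof -
  define u where "u = b * c"
  have u: "pure_basis_at n (sym_diff \<alpha> \<beta>) u"
    unfolding u_def using b c ne by (rule pure_basis_at_mult)
  note in_alg = b[THEN pure_basis_at_in_cd_algebra] c[THEN pure_basis_at_in_cd_algebra]
    u[THEN pure_basis_at_in_cd_algebra]
  have products: "c * b = - u" "b * u = - c" "u * c = - b" "u * b = c" "c * u = b"
    unfolding u_def using pure_basis_at_anticommute[OF b c ne] pure_basis_at_mult_left[OF b c]
      pure_basis_at_mult_right[OF c b] pure_basis_at_flexible(1)[OF b c ne]
      pure_basis_at_flexible(2)[OF c b ne[symmetric]]
    by simp_all
  have "d = u \<or> d = - u"
    using pure_basis_at_cases d u by blast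
  then show "associator b d c = cd_zero n" "associator d c b = cd_zero n"
    "associator c b d = cd_zero n"
    unfolding associator_def
    by (auto simp: products in_alg cd_closed[where n = n] cd_minus_mult_left[where n = n]
        cd_minus_mult_right[where n = n] cd_diff_eq_zero_iff[where n = n]
        pure_basis_at_square[OF b] pure_basis_at_square[OF c] pure_basis_at_square[OF u])
qed

section \<open>Independent triples and the three signs\<close>

text \<open>With symmetric difference as addition, the conditions on the nonempty sets \<alpha>,
  \<beta>, \<gamma> say that they are linearly independent over GF(2). Hence the indices of all
  products met below are nonempty, and anticommutation applies to them.\<close>

lemma moufang_identities_of_independent:
  assumes b: "pure_basis_at n \<alpha> b" and c: "pure_basis_at n \<beta> c" and d: "pure_basis_at n \<gamma> d"
    and "\<alpha> \<noteq> \<beta>" "\<alpha> \<noteq> \<gamma>" "\<beta> \<noteq> \<gamma>" "\<gamma> \<noteq> sym_diff \<alpha> \<beta>"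
    and na: "nonassoc_triad n b c d"
  shows "(d * (b * (d * c)) - ((d * b) * d) * c = cd_zero n
            \<longleftrightarrow> type_B n b c d \<or> type_X n b c d) \<and>
         (b * (d * (c * d)) - ((b * d) * c) * d = cd_zero n
            \<longleftrightarrow> type_C n b c d \<or> type_X n b c d) \<and>
         ((d * b) * (c * d) - (d * (b * c)) * d = cd_zero n
            \<longleftrightarrow> (malcev_identity n b c d \<longrightarrow> type_B n b c d \<or> type_X n b c d) \<and>
                (\<not> malcev_identity n b c d \<longrightarrow> type_A n b c d \<or> type_C n b c d))"
proof -
  define u v w e where "u = b * c" and "v = c * d" and "w = b * d" and "e = u * d"
  have ne: "\<alpha> \<noteq> sym_diff \<beta> \<gamma>" "\<beta> \<noteq> sym_diff \<alpha> \<gamma>" "sym_diff \<alpha> \<beta> \<noteq> \<gamma>" "sym_diff \<beta> \<gamma> \<noteq> \<alpha>"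
    "sym_diff \<alpha> \<gamma> \<noteq> \<beta>" "sym_diff \<alpha> \<gamma> \<noteq> sym_diff \<beta> \<gamma>"
    using assms(4-7) by blast+
  have u: "pure_basis_at n (sym_diff \<alpha> \<beta>) u" and v: "pure_basis_at n (sym_diff \<beta> \<gamma>) v"
    and w: "pure_basis_at n (sym_diff \<alpha> \<gamma>) w"
    unfolding u_def v_def w_def using b c d assms(4-6) by (auto intro!: pure_basis_at_mult)
  have e: "pure_basis_at n (sym_diff (sym_diff \<alpha> \<beta>) \<gamma>) e"
    unfolding e_def using u d ne by (intro pure_basis_at_mult)
  \<comment> \<open>Comparing indices shows that \<open>b * v\<close> and \<open>w * c\<close> are
    \<open>e\<close> up to sign, and \<open>w * v\<close> is \<open>u\<close> up to sign.\<close>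
  have "sym_diff \<alpha> (sym_diff \<beta> \<gamma>) = sym_diff (sym_diff \<alpha> \<beta>) \<gamma>"
    "sym_diff (sym_diff \<alpha> \<gamma>) \<beta> = sym_diff (sym_diff \<alpha> \<beta>) \<gamma>"
    "sym_diff (sym_diff \<alpha> \<gamma>) (sym_diff \<beta> \<gamma>) = sym_diff \<alpha> \<beta>"
    by blast+
  then have bv: "pure_basis_at n (sym_diff (sym_diff \<alpha> \<beta>) \<gamma>) (b * v)"
    and wc: "pure_basis_at n (sym_diff (sym_diff \<alpha> \<beta>) \<gamma>) (w * c)"
    and wv: "pure_basis_at n (sym_diff \<alpha> \<beta>) (w * v)"
    using pure_basis_at_mult[OF b v] pure_basis_at_mult[OF w c] pure_basis_at_mult[OF w v] ne
    by auto
  have signs: "b * v = e \<or> b * v = - e" "w * c = e \<or> w * c = - e" "w * v = u \<or> w * v = - u"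
    using pure_basis_at_cases bv wc wv u e by blast+
  note in_alg [simp] = b[THEN pure_basis_at_in_cd_algebra] c[THEN pure_basis_at_in_cd_algebra]
    d[THEN pure_basis_at_in_cd_algebra] u[THEN pure_basis_at_in_cd_algebra]
    v[THEN pure_basis_at_in_cd_algebra] w[THEN pure_basis_at_in_cd_algebra]
    e[THEN pure_basis_at_in_cd_algebra]
  note neg [simp] = cd_minus_mult_left[where n = n] cd_minus_mult_right[where n = n]
    cd_closed[where n = n]
  have products: "d * b = - w" "c * b = - u" "d * c = - v" "d * u = - e" "c * w = - (w * c)"
    unfolding u_def v_def w_def e_def
    using pure_basis_at_anticommute[OF b d] pure_basis_at_anticommute[OF b c]
      pure_basis_at_anticommute[OF c d] pure_basis_at_anticommute[OF u d]
      pure_basis_at_anticommute[OF w c] assms(4-6) ne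
    by (auto simp: u_def w_def)
  have cancel: "w * d = - b" "d * v = c" "e * d = - u" "d * e = u"
    unfolding v_def w_def e_def
    using pure_basis_at_mult_right[OF d b] pure_basis_at_flexible(2)[OF d c]
      pure_basis_at_mult_right[OF d u] pure_basis_at_flexible(2)[OF d u] assms(4-6) ne
    by (auto simp: u_def)
  have bvb: "(b * v) * b = v" and wvw: "(w * v) * w = v"
    using pure_basis_at_flexible(1)[OF b v] pure_basis_at_flexible(1)[OF w v] ne by auto
  have minus_eq: "- x = - y \<longleftrightarrow> x = y" for x y :: cd
    by (metis cd_minus_minus)
  have distinct: "e \<noteq> - e" "u \<noteq> - u" "v \<noteq> - v" "- e \<noteq> e" "- u \<noteq> u" "- v \<noteq> v"
    using u v e pure_basis_at_ne_minus by metis+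
  \<comment> \<open>If \<open>b * v\<close> is s times \<open>e\<close> and \<open>w * c\<close> is
    t times \<open>e\<close>, these associators are s + t, 1 - s and t - 1 times \<open>e\<close>.
    So (s, t) is (1, 1) for type A, (-1, 1) for B, (1, -1) for C and (-1, -1) for X.\<close>
  have assoc: "associator b d c = w * c - - (b * v)" "associator b c d = e - b * v"
    "associator c b d = - e - - (w * c)"
    unfolding associator_def
    by (simp_all add: products flip: u_def v_def w_def e_def)
  \<comment> \<open>With \<open>w * v\<close> equal to r times \<open>u\<close>, the right-hand
    sides are -(s + 1), 1 + t and -(r + 1) times \<open>u\<close>.\<close>
  have moufang: "d * (b * (d * c)) - ((d * b) * d) * c = - (d * (b * v)) - u"
    "b * (d * (c * d)) - ((b * d) * c) * d = u - (w * c) * d"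
    "(d * b) * (c * d) - (d * (b * c)) * d = - (w * v) - u"
    by (simp_all add: products cancel flip: u_def v_def w_def e_def)
  have malcev: "malcev_identity n b c d \<longleftrightarrow> e * b = u * w"
    unfolding malcev_identity_def
    by (simp add: products minus_eq cd_add_eq_zero_iff[where n = n]
        flip: u_def v_def w_def e_def)
  \<comment> \<open>Flexibility turns the signs s and r into \<open>e * b\<close> = s
    \<open>v\<close> and \<open>u * w\<close> = r \<open>v\<close>, so both sides of Mal'cev's
    identity become comparable.\<close>
  have eb: "e * b = v" if "b * v = e" using bvb that by simp
  have eb': "e * b = - v" if "b * v = - e" using bvb that by (simp, metis cd_minus_minus)
  have uw: "u * w = v" if "w * v = u" using wvw that by simp
  have uw': "u * w = - v" if "w * v = - u" using wvw that by (simp, metis cd_minus_minus)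
  have "malcev_identity n b c d \<longleftrightarrow> (b * v = e \<longleftrightarrow> w * v = u)"
    unfolding malcev using signs(1,3) eb eb' uw uw' distinct by metis
  \<comment> \<open>The eight sign combinations are checked one by one; a doubled basis element is
    nonzero because it differs from its negative.\<close>
  with na signs show ?thesis
    unfolding type_A_def type_B_def type_C_def type_X_def assoc moufang
    by (elim disjE) (simp_all add: cancel distinct cd_diff_eq_zero_iff[where n = n])
qed

theorem theorem6:
  fixes n :: nat and b c d :: cd
  assumes "n \<ge> 3" and "nonassoc_triad n b c d"
  shows "(d * (b * (d * c)) - ((d * b) * d) * c = cd_zero n
            \<longleftrightarrow> type_B n b c d \<or> type_X n b c d) \<and>
         (b * (d * (c * d)) - ((b * d) * c) * d = cd_zero n
            \<longleftrightarrow> type_C n b c d \<or> type_X n b c d) \<and>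
         ((d * b) * (c * d) - (d * (b * c)) * d = cd_zero n
            \<longleftrightarrow> (malcev_identity n b c d \<longrightarrow> type_B n b c d \<or> type_X n b c d) \<and>
                (\<not> malcev_identity n b c d \<longrightarrow> type_A n b c d \<or> type_C n b c d))"
proof -
  from assms(2) obtain \<alpha> \<beta> \<gamma> where b: "pure_basis_at n \<alpha> b" and c: "pure_basis_at n \<beta> c"
    and d: "pure_basis_at n \<gamma> d"
    unfolding nonassoc_triad_def triad_def cd_pure_basis_def pure_basis_at_def signed_basis_def
    by blast
  \<comment> \<open>The combination defining non-associativity would vanish with its three terms.
    This excludes every dependency among the index sets.\<close>
  have nz: "\<not> (associator b d c = cd_zero n \<and> associator d c b = cd_zero n \<and>
      associator c b d = cd_zero n)"
    using assms(2) unfolding nonassoc_triad_def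
    by (auto simp: cd_add_zero cd_diff_zero cd_zero_in_cd_algebra)
  have "\<alpha> \<noteq> \<beta>"
    using nz b c d associator_repeated by blast
  moreover have "\<alpha> \<noteq> \<gamma>"
    using nz b c d associator_repeated by blast
  moreover have "\<beta> \<noteq> \<gamma>"
    using nz b c d associator_repeated by blast
  moreover have "\<gamma> \<noteq> sym_diff \<alpha> \<beta>"
    using nz d associator_quaternion[OF b c _ \<open>\<alpha> \<noteq> \<beta>\<close>] by metis
  ultimately show ?thesis
    using assms(2) by (rule moufang_identities_of_independent[OF b c d])
qed

end
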